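(* Let $n,k,m$ be integers with $1\le k<k+m\le n$, and let $d$ be any integer. Then \[ \left\langle {n \atop d} \right\rangle_k^{k+m} = \left\langle {n-1 \atop d} \right\rangle^m \quad\text{and}\quad \left\langle {n \atop d} \right\rangle_{k+m}^k = \left\langle {n-1 \atop d-1} \right\rangle_m. \]
   Context: $S_n$ is the set of permutations of $\{1,\dots,n\}$. A descent of $\pi\in S_n$ is an index $i$ with $1\le i\le n-1$ and $\pi(i)>\pi(i+1)$; $\mathrm{Des}(\pi)$ is the number of descents. For integers $n,d,k,\ell$: $\left\langle {n \atop d} \right\rangle_k$ is the number of $\pi\in S_n$ with $\mathrm{Des}(\pi)=d$ and $\pi(1)=k$; $\left\langle {n \atop d} \right\rangle^\ell$ is the number of $\pi\in S_n$ with $\mathrm{Des}(\pi)=d$ and $\pi(n)=\ell$; and $\left\langle {n \atop d} \right\rangle_k^\ell$ is the number of $\pi\in S_n$ with $\mathrm{Des}(\pi)=d$, $\pi(1)=k$ and $\pi(n)=\ell$. Each is $0$ if no such permutation exists. *)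

theory Defs
  imports "HOL-Combinatorics.Permutations"
begin

text \<open>
  All parameters are integers, so that \<open>n - 1\<close> and \<open>d - 1\<close> are never truncated;
  in particular the counts below are 0 for negative \<open>d\<close>.
  A permutation in \<open>S\<^sub>n\<close> is a function with \<open>\<pi> permutes {1..n}\<close>, which fixes every integer
  outside \<open>{1..n}\<close>; hence distinct elements of \<open>S\<^sub>n\<close> are distinct functions.
\<close>

definition Des :: "int \<Rightarrow> (int \<Rightarrow> int) \<Rightarrow> int" where
  "Des n \<pi> = int (card {i. 1 \<le> i \<and> i \<le> n - 1 \<and> \<pi> i > \<pi> (i + 1)})"

definition eulerian_first :: "int \<Rightarrow> int \<Rightarrow> int \<Rightarrow> nat" where
  "eulerian_first n d k = card {\<pi>. \<pi> permutes {1..n} \<and> Des n \<pi> = d \<and> \<pi> 1 = k}"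

definition eulerian_last :: "int \<Rightarrow> int \<Rightarrow> int \<Rightarrow> nat" where
  "eulerian_last n d l = card {\<pi>. \<pi> permutes {1..n} \<and> Des n \<pi> = d \<and> \<pi> n = l}"

definition eulerian_first_last :: "int \<Rightarrow> int \<Rightarrow> int \<Rightarrow> int \<Rightarrow> nat" where
  "eulerian_first_last n d k l =
    card {\<pi>. \<pi> permutes {1..n} \<and> Des n \<pi> = d \<and> \<pi> 1 = k \<and> \<pi> n = l}"

end

theory Submission
  imports Defs
begin

text \<open>
  Rotate the values cyclically by subtracting \<open>k\<close> modulo \<open>n\<close>. Whether a pair of adjacent entries is
  a descent changes only when exactly one of the two entries is less than \<open>k\<close>, and these changes
  telescope, so the number of descents changes by \<open>[\<pi> 1 < k] - [\<pi> n < k]\<close>. This is 0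
  if both end entries are at least \<open>k\<close>. The entry \<open>k\<close> becomes the minimum 0 and sits at one end;
  deleting it leaves a permutation of \<open>{1..n - 1}\<close>, at the cost of no descent if it was the first
  entry and of one descent if it was the last.
\<close>

section \<open>Descent counts when an end entry is split off\<close>

lemma Des_one: "Des 1 \<pi> = 0"
proof -
  have "{i. 1 \<le> i \<and> i \<le> 1 - 1 \<and> \<pi> i > \<pi> (i + 1)} = {}"
    by auto
  then show ?thesis
    unfolding Des_def by (simp only: card.empty of_nat_0)
qed

lemma Des_Suc:
  assumes "1 \<le> n"
  shows "Des (n + 1) \<pi> = Des n \<pi> + of_bool (\<pi> n > \<pi> (n + 1))"
proof -
  let ?D = "\<lambda>n. {i. 1 \<le> i \<and> i \<le> n - 1 \<and> \<pi> i > \<pi> (i + 1)}"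
  have fin: "finite (?D n)"
    by (rule finite_subset[of _ "{1..n}"]) auto
  have "?D (n + 1) = (if \<pi> n > \<pi> (n + 1) then insert n (?D n) else ?D n)"
    using assms by (auto simp: order_le_less)
  then show ?thesis
    using fin unfolding Des_def by simp
qed

lemma Des_cong:
  assumes "\<And>i. 1 \<le> i \<Longrightarrow> i \<le> n \<Longrightarrow> \<pi> i = \<sigma> i"
  shows "Des n \<pi> = Des n \<sigma>"
proof -
  have "{i. 1 \<le> i \<and> i \<le> n - 1 \<and> \<pi> i > \<pi> (i + 1)} = {i. 1 \<le> i \<and> i \<le> n - 1 \<and> \<sigma> i > \<sigma> (i + 1)}"
    using assms by (intro Collect_cong conj_cong) auto
  then show ?thesis
    unfolding Des_def by simp
qed

text \<open>\<open>Des_Suc\<close> splits off the last entry. The version for the first entry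
  follows by induction, since lengthening the word adds the same final comparison to both
  sides.\<close>

lemma Des_remove_first:
  assumes "1 \<le> n"
  shows "Des (n + 1) \<pi> = of_bool (\<pi> 1 > \<pi> 2) + Des n (\<lambda>i. \<pi> (i + 1))"
  using assms
proof (induction n rule: int_ge_induct)
  case base
  show ?case
    using Des_Suc[of 1 \<pi>] by (simp add: Des_one)
next
  case (step n)
  then show ?case
    using Des_Suc[of "n + 1" \<pi>] Des_Suc[of n "\<lambda>i. \<pi> (i + 1)"] by simp
qed

section \<open>Cyclic rotation of values and its effect on descents\<close>

definition rotate_down :: "int \<Rightarrow> int \<Rightarrow> int \<Rightarrow> int" where
  "rotate_down n k v = (if v < k then v - k + n else v - k)"

text \<open>For \<open>1 \<le> k\<close> and \<open>k \<le> n\<close>, \<open>rotate_down\<close>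
  maps \<open>{1..n}\<close> onto \<open>{0..n - 1}\<close>, and this is the inverse map. Case
  splits in place of \<open>mod\<close> leave only linear arithmetic.\<close>

definition rotate_up :: "int \<Rightarrow> int \<Rightarrow> int \<Rightarrow> int" where
  "rotate_up n k w = (if w + k \<le> n then w + k else w + k - n)"

text \<open>The length \<open>l\<close> is kept apart from the modulus \<open>n\<close>, so that the
  induction varies the word while the rotation stays fixed. A prefix of a permutation is in general
  only injective with values in \<open>{1..n}\<close>, hence the hypotheses.\<close>

lemma Des_rotate_down:
  assumes "1 \<le> l" and "inj_on \<pi> {1..l}" and "\<pi> ` {1..l} \<subseteq> {1..n}"
  shows "Des l (\<lambda>i. rotate_down n k (\<pi> i)) = Des l \<pi> + of_bool (\<pi> 1 < k) - of_bool (\<pi> l < k)"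
  using assms
proof (induction l rule: int_ge_induct)
  case base
  show ?case
    by (simp add: Des_one)
next
  case (step l)
  have IH: "Des l (\<lambda>i. rotate_down n k (\<pi> i)) = Des l \<pi> + of_bool (\<pi> 1 < k) - of_bool (\<pi> l < k)"
    using step.prems by (intro step.IH) (auto simp: inj_on_def)
  have "\<pi> l \<noteq> \<pi> (l + 1)"
    using step.hyps step.prems(1) by (auto dest: inj_onD)
  moreover have "\<pi> l \<in> {1..n}" "\<pi> (l + 1) \<in> {1..n}"
    using step.hyps step.prems(2) by (simp_all add: image_subset_iff)
  \<comment> \<open>Rotation keeps the order of two values on the same side of \<open>k\<close> and
    reverses it otherwise: a value below \<open>k\<close> goes to at least \<open>n - k + 1\<close>,
    any other to at most \<open>n - k\<close>.\<close>
  ultimately have "of_bool (rotate_down n k (\<pi> l) > rotate_down n k (\<pi> (l + 1)))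
      = (of_bool (\<pi> l > \<pi> (l + 1)) + of_bool (\<pi> l < k) - of_bool (\<pi> (l + 1) < k) :: int)"
    by (auto simp: rotate_down_def of_bool_def)
  then show ?case
    using step.hyps by (simp add: Des_Suc IH)
qed

section \<open>Rotation with deletion as a bijection\<close>

text \<open>
  Here \<open>p\<close> is the position of the deleted entry: \<open>e = 1\<close> deletes the first one, \<open>e = 0\<close> the last.
\<close>

lemma bij_betw_rotate_delete:
  fixes n k e p :: int
  assumes k: "1 \<le> k" "k \<le> n" and ep: "e = 1 \<and> p = 1 \<or> e = 0 \<and> p = n"
  shows "bij_betw (\<lambda>\<pi> i. if i \<in> {1..n - 1} then rotate_down n k (\<pi> (i + e)) else i)
    {\<pi>. \<pi> permutes {1..n} \<and> \<pi> p = k} {\<sigma>. \<sigma> permutes {1..n - 1}}"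
\<comment> \<open>The inverse puts \<open>k\<close> back at \<open>p\<close> and undoes the position
  shift and the rotation elsewhere.\<close>
proof (rule bij_betw_byWitness[where f' = "\<lambda>\<sigma> i. if i = p then k
      else if i \<in> {1..n} then rotate_up n k (\<sigma> (i - e)) else i"])
  let ?F = "\<lambda>\<pi> i. if i \<in> {1..n - 1} then rotate_down n k (\<pi> (i + e)) else i"
  let ?G = "\<lambda>\<sigma> i. if i = p then k else if i \<in> {1..n} then rotate_up n k (\<sigma> (i - e)) else i"
  have p: "p \<in> {1..n}"
    using k ep by auto
  \<comment> \<open>Shifting by \<open>e\<close> matches \<open>{1..n - 1}\<close> with the
    positions of \<open>{1..n}\<close> other than \<open>p\<close>.\<close>
  have up: "i + e \<in> {1..n}" "i + e \<noteq> p" if "i \<in> {1..n - 1}" for i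
    using that ep by auto
  have down: "i - e \<in> {1..n - 1}" if "i \<in> {1..n}" "i \<noteq> p" for i
    using that ep by auto
  have du: "rotate_down n k (rotate_up n k w) = w" if "w \<in> {1..n - 1}" for w
    using that k by (auto simp: rotate_down_def rotate_up_def)
  have ud: "rotate_up n k (rotate_down n k v) = v" if "v \<in> {1..n}" for v
    using that k by (auto simp: rotate_down_def rotate_up_def)
  have inj_d: "inj_on (rotate_down n k) {1..n}"
    by (rule inj_on_inverseI[of _ "rotate_up n k"]) (rule ud)
  have inj_u: "inj_on (rotate_up n k) {1..n - 1}"
    by (rule inj_on_inverseI[of _ "rotate_down n k"]) (rule du)
  \<comment> \<open>Only \<open>k\<close> is rotated to 0, so the remaining values land in
    \<open>{1..n - 1}\<close>.\<close>
  have d_mem: "rotate_down n k v \<in> {1..n - 1}" if "v \<in> {1..n}" "v \<noteq> k" for v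
    using that k by (auto simp: rotate_down_def)
  have u_mem: "rotate_up n k w \<in> {1..n}" "rotate_up n k w \<noteq> k" if "w \<in> {1..n - 1}" for w
    using that k by (auto simp: rotate_up_def)
  have val: "\<pi> (i + e) \<in> {1..n}" "\<pi> (i + e) \<noteq> k"
    if "\<pi> permutes {1..n}" "\<pi> p = k" "i \<in> {1..n - 1}" for \<pi> i
    using permutes_in_image[OF that(1), of "i + e"] permutes_inj[OF that(1)] up[OF that(3)] that(2)
    by (auto dest: injD)
  have val': "\<sigma> (i - e) \<in> {1..n - 1}"
    if "\<sigma> permutes {1..n - 1}" "i \<in> {1..n}" "i \<noteq> p" for \<sigma> i
    using permutes_in_image[OF that(1), of "i - e"] down[OF that(2,3)] by simp
  show "\<forall>\<pi>\<in>{\<pi>. \<pi> permutes {1..n} \<and> \<pi> p = k}. ?G (?F \<pi>) = \<pi>"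
  proof (intro ballI ext)
    fix \<pi> i
    assume "\<pi> \<in> {\<pi>. \<pi> permutes {1..n} \<and> \<pi> p = k}"
    then have \<pi>: "\<pi> permutes {1..n}" "\<pi> p = k"
      by auto
    consider "i = p" | "i \<in> {1..n}" "i \<noteq> p" | "i \<notin> {1..n}" "i \<noteq> p"
      by blast
    then show "?G (?F \<pi>) i = \<pi> i"
    proof cases
      case 2
      then show ?thesis
        using down[OF 2] ud[of "\<pi> i"] permutes_in_image[OF \<pi>(1), of i] by auto
    next
      case 3
      then show ?thesis
        using permutes_not_in[OF \<pi>(1) 3(1)] by auto
    qed (use \<pi> in simp)
  qed
  show "\<forall>\<sigma>\<in>{\<sigma>. \<sigma> permutes {1..n - 1}}. ?F (?G \<sigma>) = \<sigma>"
  proof (intro ballI ext)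
    fix \<sigma> i
    assume "\<sigma> \<in> {\<sigma>. \<sigma> permutes {1..n - 1}}"
    then have \<sigma>: "\<sigma> permutes {1..n - 1}"
      by auto
    show "?F (?G \<sigma>) i = \<sigma> i"
    proof (cases "i \<in> {1..n - 1}")
      case True
      then show ?thesis
        using up[OF True] du[of "\<sigma> i"] permutes_in_image[OF \<sigma>, of i] by auto
    next
      case False
      then show ?thesis
        using permutes_not_in[OF \<sigma> False] by auto
    qed
  qed
  show "?F ` {\<pi>. \<pi> permutes {1..n} \<and> \<pi> p = k} \<subseteq> {\<sigma>. \<sigma> permutes {1..n - 1}}"
  proof (rule image_subsetI)
    fix \<pi>
    assume "\<pi> \<in> {\<pi>. \<pi> permutes {1..n} \<and> \<pi> p = k}"
    then have \<pi>: "\<pi> permutes {1..n}" "\<pi> p = k"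
      by auto
    have "?F \<pi> permutes {1..n - 1}"
    proof (rule inj_imp_permutes)
      show "inj_on (?F \<pi>) {1..n - 1}"
      proof (rule inj_onI)
        fix i j
        assume ij: "i \<in> {1..n - 1}" "j \<in> {1..n - 1}" and "?F \<pi> i = ?F \<pi> j"
        then have "rotate_down n k (\<pi> (i + e)) = rotate_down n k (\<pi> (j + e))"
          by simp
        then have "\<pi> (i + e) = \<pi> (j + e)"
          by (rule inj_onD[OF inj_d _ val(1)[OF \<pi> ij(1)] val(1)[OF \<pi> ij(2)]])
        from injD[OF permutes_inj[OF \<pi>(1)] this] show "i = j"
          by simp
      qed
      show "?F \<pi> i \<in> {1..n - 1}" if "i \<in> {1..n - 1}" for i
        using that d_mem[OF val[OF \<pi> that]] by simp
    qed auto
    then show "?F \<pi> \<in> {\<sigma>. \<sigma> permutes {1..n - 1}}"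
      by simp
  qed
  show "?G ` {\<sigma>. \<sigma> permutes {1..n - 1}} \<subseteq> {\<pi>. \<pi> permutes {1..n} \<and> \<pi> p = k}"
  proof (rule image_subsetI)
    fix \<sigma>
    assume "\<sigma> \<in> {\<sigma>. \<sigma> permutes {1..n - 1}}"
    then have \<sigma>: "\<sigma> permutes {1..n - 1}"
      by auto
    have "?G \<sigma> permutes {1..n}"
    proof (rule inj_imp_permutes)
      show "inj_on (?G \<sigma>) {1..n}"
      proof (rule inj_onI)
        fix i j
        assume ij: "i \<in> {1..n}" "j \<in> {1..n}" and eq: "?G \<sigma> i = ?G \<sigma> j"
        show "i = j"
        \<comment> \<open>The value \<open>k\<close> occurs at \<open>p\<close> only, because
          \<open>rotate_up\<close> never yields \<open>k\<close> on
          \<open>{1..n - 1}\<close>.\<close>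
        proof (cases "i = p \<or> j = p")
          case True
          then show ?thesis
            using eq ij u_mem(2)[OF val'[OF \<sigma> ij(1)]] u_mem(2)[OF val'[OF \<sigma> ij(2)]]
            by (auto split: if_splits)
        next
          case False
          then have "rotate_up n k (\<sigma> (i - e)) = rotate_up n k (\<sigma> (j - e))"
            using eq ij by simp
          then have "\<sigma> (i - e) = \<sigma> (j - e)"
            using False by (intro inj_onD[OF inj_u _ val'[OF \<sigma> ij(1)] val'[OF \<sigma> ij(2)]]) auto
          from injD[OF permutes_inj[OF \<sigma>] this] show ?thesis
            by simp
        qed
      qed
      show "?G \<sigma> i \<in> {1..n}" if "i \<in> {1..n}" for i
        using that k u_mem(1)[OF val'[OF \<sigma> that]] by auto
    qed (use p in auto)
    then show "?G \<sigma> \<in> {\<pi>. \<pi> permutes {1..n} \<and> \<pi> p = k}"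
      by simp
  qed
qed

text \<open>The bijection restricts to the permutations satisfying \<open>P\<close>. The equivalence
  is asked only when \<open>\<pi> p = k\<close>, so the deleted entry is known when descents are
  compared.\<close>

lemma card_rotate_delete:
  fixes n k e p :: int
  assumes k: "1 \<le> k" "k \<le> n" and ep: "e = 1 \<and> p = 1 \<or> e = 0 \<and> p = n"
    and PQ: "\<And>\<pi>. \<pi> permutes {1..n} \<Longrightarrow> \<pi> p = k \<Longrightarrow>
      P \<pi> \<longleftrightarrow> Q (\<lambda>i. if i \<in> {1..n - 1} then rotate_down n k (\<pi> (i + e)) else i)"
  shows "card {\<pi>. \<pi> permutes {1..n} \<and> \<pi> p = k \<and> P \<pi>} = card {\<sigma>. \<sigma> permutes {1..n - 1} \<and> Q \<sigma>}"
proof -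
  let ?F = "\<lambda>\<pi> i. if i \<in> {1..n - 1} then rotate_down n k (\<pi> (i + e)) else i"
  note bij = bij_betw_rotate_delete[OF k ep]
  have "?F ` {\<pi>. \<pi> permutes {1..n} \<and> \<pi> p = k \<and> P \<pi>}
      = {\<sigma> \<in> ?F ` {\<pi>. \<pi> permutes {1..n} \<and> \<pi> p = k}. Q \<sigma>}"
    using PQ by blast
  also have "\<dots> = {\<sigma>. \<sigma> permutes {1..n - 1} \<and> Q \<sigma>}"
    unfolding bij_betw_imp_surj_on[OF bij] by simp
  finally have "bij_betw ?F {\<pi>. \<pi> permutes {1..n} \<and> \<pi> p = k \<and> P \<pi>}
      {\<sigma>. \<sigma> permutes {1..n - 1} \<and> Q \<sigma>}"
    by (intro bij_betw_subset[OF bij]) auto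
  then show ?thesis
    by (rule bij_betw_same_card)
qed

section \<open>Both end values prescribed\<close>

theorem theorem10:
  fixes n k m d :: int
  assumes "1 \<le> k" and "k < k + m" and "k + m \<le> n"
  shows "eulerian_first_last n d k (k + m) = eulerian_last (n - 1) d m \<and>
         eulerian_first_last n d (k + m) k = eulerian_first (n - 1) (d - 1) m"
proof
  have k: "1 \<le> k" "k \<le> n" and n: "1 \<le> n - 1"
    using assms by auto
  \<comment> \<open>A value below \<open>k\<close> cannot wrap around to \<open>m\<close>: it would
    have to be \<open>k + m - n\<close>, which is at most 0.\<close>
  have rot_eq_m: "rotate_down n k v = m \<longleftrightarrow> v = k + m" if "v \<in> {1..n}" for v
    using that assms by (auto simp: rotate_down_def)
  have rot_pos: "rotate_down n k v > 0" if "v \<in> {1..n}" "v \<noteq> k" for v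
    using that assms by (auto simp: rotate_down_def)
  have rot_k: "rotate_down n k k = 0"
    by (simp add: rotate_down_def)
  have Des_rot: "Des n (\<lambda>i. rotate_down n k (\<pi> i)) = Des n \<pi>"
    if "\<pi> permutes {1..n}" "\<pi> 1 \<ge> k" "\<pi> n \<ge> k" for \<pi>
    using Des_rotate_down[of n \<pi> n k] that k permutes_inj_on[OF that(1)] permutes_image[OF that(1)]
    by simp

  have "card {\<pi>. \<pi> permutes {1..n} \<and> \<pi> 1 = k \<and> \<pi> n = k + m \<and> Des n \<pi> = d}
      = card {\<sigma>. \<sigma> permutes {1..n - 1} \<and> \<sigma> (n - 1) = m \<and> Des (n - 1) \<sigma> = d}"
  proof (rule card_rotate_delete[where e = 1, OF k])
    fix \<pi>
    assume \<pi>: "\<pi> permutes {1..n}" "\<pi> 1 = k"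
    let ?\<sigma> = "\<lambda>i. if i \<in> {1..n - 1} then rotate_down n k (\<pi> (i + 1)) else i"
    have last: "?\<sigma> (n - 1) = m \<longleftrightarrow> \<pi> n = k + m"
      using n rot_eq_m[of "\<pi> n"] permutes_in_image[OF \<pi>(1), of n] by simp
    \<comment> \<open>After rotation the first entry is 0 and the second is positive, so deleting
      the first loses no descent.\<close>
    have "\<pi> 2 \<in> {1..n}" "\<pi> 2 \<noteq> k"
      using n permutes_in_image[OF \<pi>(1), of 2] injD[OF permutes_inj[OF \<pi>(1)], of 2 1] \<pi>(2) by auto
    then have "rotate_down n k (\<pi> 2) > 0"
      by (rule rot_pos)
    then have "Des n (\<lambda>i. rotate_down n k (\<pi> i)) = Des (n - 1) (\<lambda>i. rotate_down n k (\<pi> (i + 1)))"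
      using Des_remove_first[OF n, of "\<lambda>i. rotate_down n k (\<pi> i)"] \<pi>(2) rot_k by simp
    \<comment> \<open>The identity padding required by \<open>permutes\<close> lies outside the
      positions that \<open>Des (n - 1)\<close> reads.\<close>
    also have "\<dots> = Des (n - 1) ?\<sigma>"
      by (rule Des_cong) simp
    \<comment> \<open>Invariance under rotation uses that both ends are at least \<open>k\<close>.
      For the last entry this comes from \<open>\<pi> n = k + m\<close>, so the equation is
      conditional and \<open>conj_cong\<close> supplies the condition below.\<close>
    finally have Des_eq: "Des (n - 1) ?\<sigma> = Des n \<pi>" if "\<pi> n = k + m"
      using Des_rot[OF \<pi>(1)] that \<pi>(2) assms by simp
    show "\<pi> n = k + m \<and> Des n \<pi> = d \<longleftrightarrow> ?\<sigma> (n - 1) = m \<and> Des (n - 1) ?\<sigma> = d"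
    proof (rule conj_cong[OF last[symmetric]])
      assume "?\<sigma> (n - 1) = m"
      then show "Des n \<pi> = d \<longleftrightarrow> Des (n - 1) ?\<sigma> = d"
        unfolding last by (simp only: Des_eq)
    qed
  qed simp
  then show "eulerian_first_last n d k (k + m) = eulerian_last (n - 1) d m"
    unfolding eulerian_first_last_def eulerian_last_def by (simp add: conj_commute conj_left_commute)

  have "card {\<pi>. \<pi> permutes {1..n} \<and> \<pi> n = k \<and> \<pi> 1 = k + m \<and> Des n \<pi> = d}
      = card {\<sigma>. \<sigma> permutes {1..n - 1} \<and> \<sigma> 1 = m \<and> Des (n - 1) \<sigma> = d - 1}"
  proof (rule card_rotate_delete[where e = 0, OF k])
    fix \<pi>
    assume \<pi>: "\<pi> permutes {1..n}" "\<pi> n = k"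
    let ?\<sigma> = "\<lambda>i. if i \<in> {1..n - 1} then rotate_down n k (\<pi> (i + 0)) else i"
    have first: "?\<sigma> 1 = m \<longleftrightarrow> \<pi> 1 = k + m"
      using n rot_eq_m[of "\<pi> 1"] permutes_in_image[OF \<pi>(1), of 1] by simp
    \<comment> \<open>Here the last entry becomes 0 after a positive one, so its deletion loses
      exactly one descent; this gives \<open>d - 1\<close>.\<close>
    have "\<pi> (n - 1) \<in> {1..n}" "\<pi> (n - 1) \<noteq> k"
      using n permutes_in_image[OF \<pi>(1), of "n - 1"]
        injD[OF permutes_inj[OF \<pi>(1)], of "n - 1" n] \<pi>(2) by auto
    then have "rotate_down n k (\<pi> (n - 1)) > 0"
      by (rule rot_pos)
    then have "Des n (\<lambda>i. rotate_down n k (\<pi> i)) = Des (n - 1) (\<lambda>i. rotate_down n k (\<pi> i)) + 1"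
      using Des_Suc[OF n, of "\<lambda>i. rotate_down n k (\<pi> i)"] \<pi>(2) rot_k by simp
    also have "Des (n - 1) (\<lambda>i. rotate_down n k (\<pi> i)) = Des (n - 1) ?\<sigma>"
      by (rule Des_cong) simp
    finally have Des_eq: "Des (n - 1) ?\<sigma> = Des n \<pi> - 1" if "\<pi> 1 = k + m"
      using Des_rot[OF \<pi>(1)] that \<pi>(2) assms by simp
    show "\<pi> 1 = k + m \<and> Des n \<pi> = d \<longleftrightarrow> ?\<sigma> 1 = m \<and> Des (n - 1) ?\<sigma> = d - 1"
    proof (rule conj_cong[OF first[symmetric]])
      assume "?\<sigma> 1 = m"
      then show "Des n \<pi> = d \<longleftrightarrow> Des (n - 1) ?\<sigma> = d - 1"
        unfolding first by (simp only: Des_eq diff_eq_eq diff_add_cancel)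
    qed
  qed simp
  then show "eulerian_first_last n d (k + m) k = eulerian_first (n - 1) (d - 1) m"
    unfolding eulerian_first_last_def eulerian_first_def by (simp add: conj_commute conj_left_commute)
qed

end
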